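(* Let $\phi$ be a bounded STL formula with future and past formula lengths $L^\phi_f$ and $L^\phi_p$, let $t\in\mathbb{Z}$, and let $T_L:=\{t-L^\phi_p,\dots,t,\dots,t+L^\phi_f\}\subseteq\mathbb{Z}$. Let $X:\Omega\times T_L\to\mathcal{X}$ be a discrete-time stochastic process with a finite state space $\mathcal{X}\subseteq\mathbb{R}^n$, and let $f_X(x)$, $x\in\mathfrak{F}(T_L,\mathcal{X})$, be its probability mass function. Then the probability mass function $f_Z$ and the cumulative distribution function $F_Z$ of $Z:=-\rho^\phi(X,t)$ are given by $$f_Z(z)=\sum_{x\in\mathfrak{F}(T_L,\mathcal{X})}\mathbb{I}(-\rho^\phi(x,t)=z)\,f_X(x),\qquad F_Z(z)=\sum_{x\in\mathfrak{F}(T_L,\mathcal{X})}\mathbb{I}(-\rho^\phi(x,t)\le z)\,f_X(x).$$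
   Context: $\mathfrak{F}(T_L,\mathcal{X})$ is the (finite) set of functions $T_L\to\mathcal{X}$; $f_X(x)=P(\{\omega: X(\omega,s)=x(s)\ \forall s\in T_L\})$; $f_Z(z)=P(Z=z)$, $F_Z(z)=P(Z\le z)$; $\mathbb{I}$ is the $0/1$ indicator. STL (time domain $T=\mathbb{Z}$). A predicate is $\mu:\mathbb{R}^n\to\{\top,\bot\}$ with $O^\mu:=\mu^{-1}(\top)$, $O^{\neg\mu}:=\mathbb{R}^n\setminus O^\mu$, both assumed nonempty and Borel. STL formulas: $\phi::=\top\mid\mu\mid\neg\phi\mid\phi'\wedge\phi''\mid\phi'U_I\phi''\mid\phi'\underline U_I\phi''$ with intervals $I\subseteq\mathbb{R}_{\ge0}$; $\phi$ is bounded if all intervals $I$ are compact. For a metric $d$ on $\mathbb{R}^n$ let $\bar d(\zeta,S):=\inf_{\zeta'\in S}d(\zeta,\zeta')$. Robust semantics of $x:\mathbb{Z}\to\mathbb{R}^n$: $\rho^\top(x,t)=\infty$; $\rho^\mu(x,t)=\bar d(x(t),\mathrm{cl}(O^{\neg\mu}))$ if $x(t)\in O^\mu$, else $-\bar d(x(t),\mathrm{cl}(O^\mu))$; $\rho^{\neg\phi}=-\rho^\phi$; $\rho^{\phi'\wedge\phi''}=\min(\rho^{\phi'},\rho^{\phi''})$; $\rho^{\phi'U_I\phi''}(x,t)=\sup_{t''\in(t\oplus I)\cap\mathbb{Z}}\min\big(\rho^{\phi''}(x,t''),\inf_{t'\in(t,t'')\cap\mathbb{Z}}\rho^{\phi'}(x,t')\big)$;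 $\rho^{\phi'\underline U_I\phi''}(x,t)=\sup_{t''\in(t\ominus I)\cap\mathbb{Z}}\min\big(\rho^{\phi''}(x,t''),\inf_{t'\in(t'',t)\cap\mathbb{Z}}\rho^{\phi'}(x,t')\big)$, where $t\oplus I=\{t+s:s\in I\}$, $t\ominus I=\{t-s:s\in I\}$ and $\sup\emptyset=-\infty$, $\inf\emptyset=\infty$. Formula lengths: $L_f^\top=L_f^\mu=0$, $L_f^{\neg\phi}=L_f^\phi$, $L_f^{\phi'\wedge\phi''}=\max(L_f^{\phi'},L_f^{\phi''})$, $L_f^{\phi'U_I\phi''}=\max(I\cap\mathbb{Z})+\max(L_f^{\phi'},L_f^{\phi''})$, $L_f^{\phi'\underline U_I\phi''}=\max(L_f^{\phi'},L_f^{\phi''})$; $L_p^\top=L_p^\mu=0$, $L_p^{\neg\phi}=L_p^\phi$, $L_p^{\phi'\wedge\phi''}=\max(L_p^{\phi'},L_p^{\phi''})$, $L_p^{\phi'U_I\phi''}=\max(L_p^{\phi'},L_p^{\phi''})$, $L_p^{\phi'\underline U_I\phi''}=\max(I\cap\mathbb{Z})+\max(L_p^{\phi'},L_p^{\phi''})$ (the intervals $I$ are understood to contain an integer). The value $\rho^\phi(x,t)$ depends only on $x$ restricted to $T_L$; for $x:T_L\to\mathcal{X}$, $\rho^\phi(x,t)$ means the value for any extension of $x$ to $\mathbb{Z}$. *)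

theory Defs
  imports "HOL-Probability.Probability"
begin

datatype 'a stl =
    Top
  | Atom "'a \<Rightarrow> bool"
  | Neg "'a stl"
  | And "'a stl" "'a stl"
  | Until "real set" "'a stl" "'a stl"
  | Since "real set" "'a stl" "'a stl"

definition sat_set :: "('a \<Rightarrow> bool) \<Rightarrow> 'a set" where
  "sat_set \<mu> = {\<zeta>. \<mu> \<zeta>}"

definition admissible_predicate :: "('a::topological_space \<Rightarrow> bool) \<Rightarrow> bool" where
  "admissible_predicate \<mu> \<longleftrightarrow>
     sat_set \<mu> \<noteq> {} \<and> - sat_set \<mu> \<noteq> {} \<and>
     sat_set \<mu> \<in> sets borel \<and> - sat_set \<mu> \<in> sets borel"

definition integer_points :: "real set \<Rightarrow> int set" where
  "integer_points I = {k. real_of_int k \<in> I}"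

definition time_interval :: "real set \<Rightarrow> bool" where
  "time_interval I \<longleftrightarrow> is_interval I \<and> I \<subseteq> {0..} \<and> integer_points I \<noteq> {}"

primrec stl_formula :: "'a::topological_space stl \<Rightarrow> bool" where
  "stl_formula Top \<longleftrightarrow> True"
| "stl_formula (Atom \<mu>) \<longleftrightarrow> admissible_predicate \<mu>"
| "stl_formula (Neg \<phi>) \<longleftrightarrow> stl_formula \<phi>"
| "stl_formula (And \<phi> \<psi>) \<longleftrightarrow> stl_formula \<phi> \<and> stl_formula \<psi>"
| "stl_formula (Until I \<phi> \<psi>) \<longleftrightarrow> time_interval I \<and> stl_formula \<phi> \<and> stl_formula \<psi>"
| "stl_formula (Since I \<phi> \<psi>) \<longleftrightarrow> time_interval I \<and> stl_formula \<phi> \<and> stl_formula \<psi>"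

primrec bounded_stl :: "'a stl \<Rightarrow> bool" where
  "bounded_stl Top \<longleftrightarrow> True"
| "bounded_stl (Atom \<mu>) \<longleftrightarrow> True"
| "bounded_stl (Neg \<phi>) \<longleftrightarrow> bounded_stl \<phi>"
| "bounded_stl (And \<phi> \<psi>) \<longleftrightarrow> bounded_stl \<phi> \<and> bounded_stl \<psi>"
| "bounded_stl (Until I \<phi> \<psi>) \<longleftrightarrow> compact I \<and> bounded_stl \<phi> \<and> bounded_stl \<psi>"
| "bounded_stl (Since I \<phi> \<psi>) \<longleftrightarrow> compact I \<and> bounded_stl \<phi> \<and> bounded_stl \<psi>"

definition dist_to_set :: "('a \<Rightarrow> 'a \<Rightarrow> real) \<Rightarrow> 'a \<Rightarrow> 'a set \<Rightarrow> ereal" where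
  "dist_to_set d \<zeta> S = (INF \<zeta>'\<in>S. ereal (d \<zeta> \<zeta>'))"

text \<open>Robustness values are extended reals, where the supremum and infimum of the empty set
  are \<open>-\<infinity>\<close> and \<open>\<infinity>\<close>. The function \<open>d\<close> is the metric measuring distances between states;
  closures are taken in the topology of the state type.\<close>

primrec robustness ::
  "('a::topological_space \<Rightarrow> 'a \<Rightarrow> real) \<Rightarrow> 'a stl \<Rightarrow> (int \<Rightarrow> 'a) \<Rightarrow> int \<Rightarrow> ereal" where
  "robustness d Top x t = \<infinity>"
| "robustness d (Atom \<mu>) x t =
     (if x t \<in> sat_set \<mu> then dist_to_set d (x t) (closure (- sat_set \<mu>))
      else - dist_to_set d (x t) (closure (sat_set \<mu>)))"
| "robustness d (Neg \<phi>) x t = - robustness d \<phi> x t"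
| "robustness d (And \<phi> \<psi>) x t = min (robustness d \<phi> x t) (robustness d \<psi> x t)"
| "robustness d (Until I \<phi> \<psi>) x t =
     (SUP t'' \<in> integer_points ((\<lambda>s. real_of_int t + s) ` I).
        min (robustness d \<psi> x t'') (INF t' \<in> {t<..<t''}. robustness d \<phi> x t'))"
| "robustness d (Since I \<phi> \<psi>) x t =
     (SUP t'' \<in> integer_points ((\<lambda>s. real_of_int t - s) ` I).
        min (robustness d \<psi> x t'') (INF t' \<in> {t''<..<t}. robustness d \<phi> x t'))"

primrec future_length :: "'a stl \<Rightarrow> int" where
  "future_length Top = 0"
| "future_length (Atom \<mu>) = 0"
| "future_length (Neg \<phi>) = future_length \<phi>"
| "future_length (And \<phi> \<psi>) = max (future_length \<phi>) (future_length \<psi>)"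
| "future_length (Until I \<phi> \<psi>) =
     Max (integer_points I) + max (future_length \<phi>) (future_length \<psi>)"
| "future_length (Since I \<phi> \<psi>) = max (future_length \<phi>) (future_length \<psi>)"

primrec past_length :: "'a stl \<Rightarrow> int" where
  "past_length Top = 0"
| "past_length (Atom \<mu>) = 0"
| "past_length (Neg \<phi>) = past_length \<phi>"
| "past_length (And \<phi> \<psi>) = max (past_length \<phi>) (past_length \<psi>)"
| "past_length (Until I \<phi> \<psi>) = max (past_length \<phi>) (past_length \<psi>)"
| "past_length (Since I \<phi> \<psi>) =
     Max (integer_points I) + max (past_length \<phi>) (past_length \<psi>)"

definition time_window :: "'a stl \<Rightarrow> int \<Rightarrow> int set" where
  "time_window \<phi> t = {t - past_length \<phi> .. t + future_length \<phi>}"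

text \<open>A process on the finite time set \<open>T\<close> is a function on all of \<open>int\<close>, whose values off \<open>T\<close>
  are unconstrained and play the role of an arbitrary extension.\<close>

definition finite_state_process ::
  "'w measure \<Rightarrow> int set \<Rightarrow> 'a::topological_space set \<Rightarrow> ('w \<Rightarrow> int \<Rightarrow> 'a) \<Rightarrow> bool" where
  "finite_state_process M T \<X> X \<longleftrightarrow>
     finite \<X> \<and>
     (\<forall>s\<in>T. (\<lambda>\<omega>. X \<omega> s) \<in> borel_measurable M) \<and>
     (\<forall>\<omega>\<in>space M. \<forall>s\<in>T. X \<omega> s \<in> \<X>)"

definition process_pmf ::
  "'w measure \<Rightarrow> int set \<Rightarrow> ('w \<Rightarrow> int \<Rightarrow> 'a) \<Rightarrow> (int \<Rightarrow> 'a) \<Rightarrow> real" where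
  "process_pmf M T X x = \<P>(\<omega> in M. \<forall>s\<in>T. X \<omega> s = x s)"

definition rv_pmf :: "'w measure \<Rightarrow> ('w \<Rightarrow> ereal) \<Rightarrow> ereal \<Rightarrow> real" where
  "rv_pmf M Z z = \<P>(\<omega> in M. Z \<omega> = z)"

definition rv_cdf :: "'w measure \<Rightarrow> ('w \<Rightarrow> ereal) \<Rightarrow> ereal \<Rightarrow> real" where
  "rv_cdf M Z z = \<P>(\<omega> in M. Z \<omega> \<le> z)"

end

theory Submission imports Defs begin

text \<open>The robustness at \<open>t\<close> is a function of the path restricted to the window, and on a finite
  state space there are finitely many such restrictions. The event that the path satisfies a
  property depending only on the window is therefore a finite disjoint union of the events
  that the restriction equals a given \<open>x\<close>, and additivity of the measure gives both sums.\<close>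

text \<open>A compact set is bounded, so its integers lie in a finite integer interval. This is what
  makes \<open>Max (integer_points I)\<close> in the formula lengths a genuine maximum.\<close>

lemma finite_integer_points:
  assumes "compact I"
  shows "finite (integer_points I)"
proof -
  obtain B where "\<And>s. s \<in> I \<Longrightarrow> \<bar>s\<bar> \<le> B"
    using compact_imp_bounded[OF assms] by (auto simp: bounded_iff)
  then have "\<bar>real_of_int k\<bar> \<le> B" if "k \<in> integer_points I" for k
    using that by (simp add: integer_points_def)
  then have "\<bar>k\<bar> \<le> \<lceil>B\<rceil>" if "k \<in> integer_points I" for k
    using that le_of_int_ceiling[of B] by (metis of_int_abs of_int_le_iff order_trans)
  then have "integer_points I \<subseteq> {- \<lceil>B\<rceil>..\<lceil>B\<rceil>}"
    by (auto simp: abs_le_iff minus_le_iff)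
  then show ?thesis
    by (rule finite_subset) simp
qed

lemma integer_points_bounds:
  assumes "time_interval I" and "compact I" and "k \<in> integer_points I"
  shows "0 \<le> k" and "k \<le> Max (integer_points I)"
  using assms finite_integer_points[of I]
  by (auto simp: time_interval_def integer_points_def)

text \<open>Since \<open>t\<close> is an integer, translation by \<open>t\<close> preserves
  integrality; bounds on \<open>integer_points I\<close> thus become bounds on the evaluation times
  of \<open>Until\<close>.\<close>

lemma integer_points_plus: "k \<in> integer_points ((\<lambda>s. real_of_int t + s) ` I) \<longleftrightarrow> k - t \<in> integer_points I"
  by (auto simp: integer_points_def image_iff intro: bexI[of _ "real_of_int (k - t)"])

lemma integer_points_minus: "k \<in> integer_points ((\<lambda>s. real_of_int t - s) ` I) \<longleftrightarrow> t - k \<in> integer_points I"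
  by (auto simp: integer_points_def image_iff intro: bexI[of _ "real_of_int (t - k)"])

lemma finite_time_window: "finite (time_window \<phi> t)"
  by (simp add: time_window_def)

text \<open>Induction with \<open>t\<close> arbitrary, because temporal operators evaluate their
  subformulas at other times. The formula lengths are chosen so that the window of a subformula at
  each such time lies in the window of the whole formula.\<close>

lemma robustness_cong:
  assumes "stl_formula \<phi>" and "bounded_stl \<phi>"
    and "\<And>s. s \<in> time_window \<phi> t \<Longrightarrow> x s = y s"
  shows "robustness d \<phi> x t = robustness d \<phi> y t"
  using assms
proof (induction \<phi> arbitrary: t)
  case (Neg \<phi>)
  then have "robustness d \<phi> x t = robustness d \<phi> y t"
    by (auto simp: time_window_def)
  then show ?case by simp
next
  case (And \<phi> \<psi>)
  have "time_window \<phi> t \<subseteq> time_window (And \<phi> \<psi>) t" "time_window \<psi> t \<subseteq> time_window (And \<phi> \<psi>) t"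
    by (auto simp: time_window_def)
  then have "robustness d \<phi> x t = robustness d \<phi> y t" "robustness d \<psi> x t = robustness d \<psi> y t"
    using And.prems by (auto intro!: And.IH)
  then show ?case by simp
next
  case (Until I \<phi> \<psi>)
  have bounds: "t \<le> t''" "t'' \<le> t + Max (integer_points I)"
    if "t'' \<in> integer_points ((\<lambda>s. real_of_int t + s) ` I)" for t''
    using integer_points_bounds[of I "t'' - t"] that Until.prems
    by (auto simp: integer_points_plus)
  show ?case
    unfolding robustness.simps
  proof (intro SUP_cong INF_cong arg_cong2[where f = min] refl)
    fix t'' assume "t'' \<in> integer_points ((\<lambda>s. real_of_int t + s) ` I)"
    note b = bounds[OF this]
    show "robustness d \<psi> x t'' = robustness d \<psi> y t''"
    proof (rule Until.IH)
      \<comment> \<open>The lower end is safe by t \<le> t''; at the upper end the summand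
        \<open>Max (integer_points I)\<close> of \<open>future_length\<close> absorbs the shift from
        t to t''.\<close>
      have "time_window \<psi> t'' \<subseteq> time_window (Until I \<phi> \<psi>) t"
        using b by (auto simp: time_window_def)
      then show "x s = y s" if "s \<in> time_window \<psi> t''" for s
        using Until.prems(3) that by blast
    qed (use Until.prems in simp_all)
    \<comment> \<open>Here t' lies strictly between t and t'', so it inherits the bounds of
      t''.\<close>
    show "robustness d \<phi> x t' = robustness d \<phi> y t'" if "t' \<in> {t<..<t''}" for t'
    proof (rule Until.IH)
      have "time_window \<phi> t' \<subseteq> time_window (Until I \<phi> \<psi>) t"
        using b that by (auto simp: time_window_def)
      then show "x s = y s" if "s \<in> time_window \<phi> t'" for s
        using Until.prems(3) that by blast
    qed (use Until.prems in simp_all)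
  qed
next
  case (Since I \<phi> \<psi>)
  \<comment> \<open>Time-reversed form of the previous case: the shift is now absorbed by
    \<open>past_length\<close>.\<close>
  have bounds: "t'' \<le> t" "t - Max (integer_points I) \<le> t''"
    if "t'' \<in> integer_points ((\<lambda>s. real_of_int t - s) ` I)" for t''
    using integer_points_bounds[of I "t - t''"] that Since.prems
    by (auto simp: integer_points_minus)
  show ?case
    unfolding robustness.simps
  proof (intro SUP_cong INF_cong arg_cong2[where f = min] refl)
    fix t'' assume "t'' \<in> integer_points ((\<lambda>s. real_of_int t - s) ` I)"
    note b = bounds[OF this]
    show "robustness d \<psi> x t'' = robustness d \<psi> y t''"
    proof (rule Since.IH)
      have "time_window \<psi> t'' \<subseteq> time_window (Since I \<phi> \<psi>) t"
        using b by (auto simp: time_window_def)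
      then show "x s = y s" if "s \<in> time_window \<psi> t''" for s
        using Since.prems(3) that by blast
    qed (use Since.prems in simp_all)
    show "robustness d \<phi> x t' = robustness d \<phi> y t'" if "t' \<in> {t''<..<t}" for t'
    proof (rule Since.IH)
      have "time_window \<phi> t' \<subseteq> time_window (Since I \<phi> \<psi>) t"
        using b that by (auto simp: time_window_def)
      then show "x s = y s" if "s \<in> time_window \<phi> t'" for s
        using Since.prems(3) that by blast
    qed (use Since.prems in simp_all)
  qed
\<comment> \<open>For \<open>Top\<close> and \<open>Atom\<close> both lengths are 0, so the window
  is the single point t.\<close>
qed (auto simp: time_window_def)

text \<open>A general \<open>Q\<close> covers the mass function and the distribution function at
  once. Measurability of the event of \<open>Q\<close> need not be assumed: the event is a finite
  union of the measurable sets \<open>E x\<close>.\<close>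

lemma prob_path_property_eq_sum:
  fixes X :: "'w \<Rightarrow> int \<Rightarrow> 'a::t1_space"
  assumes "prob_space M" and "finite T" and process: "finite_state_process M T \<X> X"
    and Q_cong: "\<And>x y. (\<And>s. s \<in> T \<Longrightarrow> x s = y s) \<Longrightarrow> Q x \<longleftrightarrow> Q y"
  shows "\<P>(\<omega> in M. Q (X \<omega>)) = (\<Sum>x \<in> T \<rightarrow>\<^sub>E \<X>. of_bool (Q x) * process_pmf M T X x)"
proof -
  interpret prob_space M by fact
  define E where "E x = {\<omega> \<in> space M. \<forall>s\<in>T. X \<omega> s = x s}" for x
  define S where "S = {x \<in> T \<rightarrow>\<^sub>E \<X>. Q x}"
  have fin: "finite (T \<rightarrow>\<^sub>E \<X>)"
    using process \<open>finite T\<close> by (auto simp: finite_state_process_def intro: finite_PiE)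
  then have "finite S"
    by (simp add: S_def)
  have E_sets: "E x \<in> sets M" for x
    unfolding E_def
  proof (rule sets.sets_Collect_finite_All[OF _ \<open>finite T\<close>])
    fix s assume "s \<in> T"
    then have [measurable]: "(\<lambda>\<omega>. X \<omega> s) \<in> borel_measurable M"
      using process by (simp add: finite_state_process_def)
    \<comment> \<open>Singletons are closed in a T1 space, hence Borel.\<close>
    have "(\<lambda>\<omega>. X \<omega> s) -` {x s} \<inter> space M \<in> sets M"
      by (rule measurable_sets) (auto intro: borel_closed)
    then show "{\<omega> \<in> space M. X \<omega> s = x s} \<in> sets M"
      by (simp add: vimage_def Int_def conj_commute)
  qed
  have "disjoint_family_on E S"
    unfolding disjoint_family_on_def
  proof (intro ballI impI)
    fix x y assume "x \<in> S" "y \<in> S" "x \<noteq> y"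
    \<comment> \<open>Members of the extensional function space agree off \<open>T\<close>, so
      distinct ones differ at a point of \<open>T\<close>.\<close>
    then have "\<exists>s\<in>T. x s \<noteq> y s"
      unfolding S_def by (metis (mono_tags, lifting) PiE_ext mem_Collect_eq)
    then show "E x \<inter> E y = {}"
      by (auto simp: E_def)
  qed
  have "{\<omega> \<in> space M. Q (X \<omega>)} = (\<Union>x\<in>S. E x)"
  proof (intro set_eqI iffI)
    fix \<omega> assume "\<omega> \<in> {\<omega> \<in> space M. Q (X \<omega>)}"
    then have \<omega>: "\<omega> \<in> space M" "Q (X \<omega>)" by auto
    \<comment> \<open>The cell containing \<omega> is indexed by its own path, made
      \<open>undefined\<close> off \<open>T\<close> to be extensional; \<open>Q_cong\<close> shows
      that \<open>Q\<close> survives the restriction.\<close>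
    then have "restrict (X \<omega>) T \<in> S"
      using process Q_cong[of "restrict (X \<omega>) T" "X \<omega>"]
      by (auto simp: S_def finite_state_process_def)
    moreover have "\<omega> \<in> E (restrict (X \<omega>) T)"
      using \<omega> by (simp add: E_def)
    ultimately show "\<omega> \<in> (\<Union>x\<in>S. E x)" by blast
  next
    fix \<omega> assume "\<omega> \<in> (\<Union>x\<in>S. E x)"
    then obtain x where "Q x" "\<omega> \<in> space M" "\<forall>s\<in>T. X \<omega> s = x s"
      by (auto simp: S_def E_def)
    then show "\<omega> \<in> {\<omega> \<in> space M. Q (X \<omega>)}"
      using Q_cong[of "X \<omega>" x] by simp
  qed
  then have "\<P>(\<omega> in M. Q (X \<omega>)) = (\<Sum>x\<in>S. prob (E x))"
    using finite_measure_finite_Union[OF \<open>finite S\<close> _ \<open>disjoint_family_on E S\<close>] E_sets by auto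
  also have "\<dots> = (\<Sum>x \<in> T \<rightarrow>\<^sub>E \<X>. of_bool (Q x) * process_pmf M T X x)"
    unfolding S_def E_def process_pmf_def using fin
    by (simp add: sum.inter_filter of_bool_def if_distrib[where f = "\<lambda>c. c * _"] cong: if_cong)
  finally show ?thesis .
qed

theorem proposition4:
  fixes d :: "real ^ 'n \<Rightarrow> real ^ 'n \<Rightarrow> real"
    and \<phi> :: "(real ^ 'n) stl"
    and t :: int
    and M :: "'w measure"
    and \<X> :: "(real ^ 'n) set"
    and X :: "'w \<Rightarrow> int \<Rightarrow> real ^ 'n"
    and ext :: "(int \<Rightarrow> real ^ 'n) \<Rightarrow> int \<Rightarrow> real ^ 'n"
  defines "T\<^sub>L \<equiv> time_window \<phi> t"
  defines "Z \<equiv> \<lambda>\<omega>. - robustness d \<phi> (X \<omega>) t"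
  assumes "Metric_space UNIV d"
    and "stl_formula \<phi>" and "bounded_stl \<phi>"
    and "prob_space M"
    and "finite_state_process M T\<^sub>L \<X> X"
    and "\<And>x s. x \<in> T\<^sub>L \<rightarrow>\<^sub>E \<X> \<Longrightarrow> s \<in> T\<^sub>L \<Longrightarrow> ext x s = x s"
  shows "(\<forall>z. rv_pmf M Z z =
           (\<Sum>x \<in> T\<^sub>L \<rightarrow>\<^sub>E \<X>.
              of_bool (- robustness d \<phi> (ext x) t = z) * process_pmf M T\<^sub>L X x)) \<and>
         (\<forall>z. rv_cdf M Z z =
           (\<Sum>x \<in> T\<^sub>L \<rightarrow>\<^sub>E \<X>.
              of_bool (- robustness d \<phi> (ext x) t \<le> z) * process_pmf M T\<^sub>L X x))"
proof -
  have rob: "robustness d \<phi> x t = robustness d \<phi> y t" if "\<And>s. s \<in> T\<^sub>L \<Longrightarrow> x s = y s" for x y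
    using robustness_cong assms(4,5) that unfolding T\<^sub>L_def by blast
  \<comment> \<open>The choice of extension is immaterial: \<open>ext x\<close> and \<open>x\<close>
    agree on the window.\<close>
  have ext: "robustness d \<phi> (ext x) t = robustness d \<phi> x t" if "x \<in> T\<^sub>L \<rightarrow>\<^sub>E \<X>" for x
    using assms(8)[OF that] by (rule rob)
  \<comment> \<open>The predicate \<open>P\<close> is later instantiated to equality with z and to
    being at most z.\<close>
  have key: "\<P>(\<omega> in M. P (Z \<omega>)) =
      (\<Sum>x \<in> T\<^sub>L \<rightarrow>\<^sub>E \<X>. of_bool (P (- robustness d \<phi> (ext x) t)) * process_pmf M T\<^sub>L X x)" for P
  proof -
    have "\<P>(\<omega> in M. P (Z \<omega>)) =
        (\<Sum>x \<in> T\<^sub>L \<rightarrow>\<^sub>E \<X>. of_bool (P (- robustness d \<phi> x t)) * process_pmf M T\<^sub>L X x)"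
      unfolding Z_def
    proof (rule prob_path_property_eq_sum[OF assms(6) _ assms(7)])
      show "finite T\<^sub>L"
        unfolding T\<^sub>L_def by (rule finite_time_window)
    qed (metis rob)
    also have "\<dots> = (\<Sum>x \<in> T\<^sub>L \<rightarrow>\<^sub>E \<X>. of_bool (P (- robustness d \<phi> (ext x) t)) * process_pmf M T\<^sub>L X x)"
      by (rule sum.cong) (simp_all add: ext)
    finally show ?thesis .
  qed
  show ?thesis
    unfolding rv_pmf_def rv_cdf_def by (intro conjI allI key)
qed

end
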